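(* Let $f\in C^{2}([a,b])$ be a real-valued function and put $M=\sup\{f''(x):x\in[a,b]\}$ and $m=\inf\{f''(x):x\in[a,b]\}$. Then for all $x,y,z\in[a,b]$, $$\frac{M}{36}\left((x-y)^{2}+(y-z)^{2}+(z-x)^{2}\right)\ \geq\ \frac{f(x)+f(y)+f(z)}{3}+f\left(\frac{x+y+z}{3}\right)-\frac{2}{3}\left(f\left(\frac{x+y}{2}\right)+f\left(\frac{y+z}{2}\right)+f\left(\frac{z+x}{2}\right)\right)\ \geq\ \frac{m}{36}\left((x-y)^{2}+(y-z)^{2}+(z-x)^{2}\right).$$ *)

theory Defs
  imports "HOL-Analysis.Analysis"
begin

text \<open>
  Derivatives are taken within the set \<open>S\<close>, so that on a nondegenerate compact interval
  they are one-sided at the endpoints; values of \<open>f\<close> outside \<open>S\<close> are irrelevant.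
\<close>

definition deriv_within :: "real set \<Rightarrow> (real \<Rightarrow> real) \<Rightarrow> real \<Rightarrow> real" where
  "deriv_within S f x = vector_derivative f (at x within S)"

definition C2_on :: "real set \<Rightarrow> (real \<Rightarrow> real) \<Rightarrow> bool" where
  "C2_on S f \<longleftrightarrow>
     f differentiable_on S \<and>
     deriv_within S f differentiable_on S \<and>
     continuous_on S (deriv_within S (deriv_within S f))"

end

theory Submission imports Defs begin

text \<open>
  If \<open>c\<close> is the mean of \<open>x, y, z\<close>, two of the three numbers lie on the same side of \<open>c\<close>. Convexity
  on the segment from \<open>c\<close> to the third number, and at the midpoint of the first two, gives
  Popoviciu's inequality. It is applied to the convex functions \<open>f - m t\<^sup>2 / 2\<close> and
  \<open>M t\<^sup>2 / 2 - f\<close>; the quadratic terms produce exactly the two bounds.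
\<close>

lemma popoviciu_same_side:
  fixes g :: "real \<Rightarrow> real"
  assumes cv: "convex_on S g" and S: "x \<in> S" "y \<in> S" "z \<in> S"
    and c: "c = (x + y + z) / 3" and side: "(c - x) * (c - y) \<ge> 0"
  shows "2 / 3 * (g ((x + y) / 2) + g ((y + z) / 2) + g ((z + x) / 2))
           \<le> (g x + g y + g z) / 3 + g c"
\<comment> \<open>If \<open>z = c\<close>, then \<open>c - x\<close> and \<open>c - y\<close> are
  opposite numbers, so \<open>side\<close> forces both to vanish. This degenerate case is split off
  because the weights below divide by \<open>z - c\<close>.\<close>
proof (cases "z = c")
  case True
  with c have "c - y = - (c - x)" by simp
  with side have "c - x = 0"
    by (metis mult_minus_right neg_0_le_iff_le zero_le_square order_antisym mult_eq_0_iff)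
  with c True have "x = c" "y = c" by auto
  with True show ?thesis by simp
next
  case False
  \<comment> \<open>Here \<open>w\<close> equals \<open>z - c\<close>. Since
    \<open>y + z = 3 * c - x\<close>, the midpoint of \<open>y\<close> and \<open>z\<close> is
    \<open>c + (c - x) / 2\<close>, that is, \<open>c + s * w\<close>; likewise the midpoint of
    \<open>z\<close> and \<open>x\<close> is \<open>c + t * w\<close>. By \<open>side\<close> the
    two summands of \<open>w\<close> do not differ in sign, so \<open>s\<close> and \<open>t\<close>
    are nonnegative with sum 1/2.\<close>
  define w where "w = (c - x) + (c - y)"
  define s where "s = (c - x) / (2 * w)"
  define t where "t = (c - y) / (2 * w)"
  have zc: "z = c + w" using c unfolding w_def by (simp add: field_simps)
  with False have w: "w \<noteq> 0" by simp
  have st: "s + t = 1 / 2" using w unfolding s_def t_def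
    by (simp add: add_divide_distrib[symmetric] w_def[symmetric])
  have st0: "0 \<le> s" "0 \<le> t"
    using side unfolding s_def t_def w_def
    by (auto simp: zero_le_divide_iff zero_le_mult_iff)
  have cS: "c \<in> S"
  proof -
    note D = convexD[OF convex_on_imp_convex[OF cv]]
    have "(1/2) *\<^sub>R x + (1/2) *\<^sub>R y \<in> S" by (rule D) (use S in auto)
    then have "(2/3) *\<^sub>R ((1/2) *\<^sub>R x + (1/2) *\<^sub>R y) + (1/3) *\<^sub>R z \<in> S"
      by (rule D) (use S in auto)
    also have "(2/3) *\<^sub>R ((1/2) *\<^sub>R x + (1/2) *\<^sub>R y) + (1/3) *\<^sub>R z = c"
      using c by (simp add: field_simps)
    finally show ?thesis .
  qed
  have yz: "(y + z) / 2 = (1 - s) *\<^sub>R c + s *\<^sub>R z"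
  proof -
    have "s * w = (c - x) / 2" using w unfolding s_def by simp
    then show ?thesis using c unfolding zc by (simp add: algebra_simps)
  qed
  have zx: "(z + x) / 2 = (1 - t) *\<^sub>R c + t *\<^sub>R z"
  proof -
    have "t * w = (c - y) / 2" using w unfolding t_def by simp
    then show ?thesis using c unfolding zc by (simp add: algebra_simps)
  qed
  have 1: "g ((y + z) / 2) \<le> (1 - s) * g c + s * g z"
    unfolding yz by (rule convex_onD[OF cv]) (use st st0 cS S in auto)
  have 2: "g ((z + x) / 2) \<le> (1 - t) * g c + t * g z"
    unfolding zx by (rule convex_onD[OF cv]) (use st st0 cS S in auto)
  have 3: "g ((x + y) / 2) \<le> (g x + g y) / 2"
    using convex_onD[OF cv, of "1/2" x y] S by (simp add: field_simps)
  \<comment> \<open>Only the sum \<open>s + t\<close> matters: scaled by 2/3, the two bounds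
    together give \<open>g c + g z / 3\<close>, and fact \<open>3\<close> supplies
    \<open>(g x + g y) / 3\<close>.\<close>
  have "(1 - s) * g c + s * g z + ((1 - t) * g c + t * g z)
      = (2 - (s + t)) * g c + (s + t) * g z" by (simp add: algebra_simps)
  also have "\<dots> = 3 / 2 * g c + 1 / 2 * g z" unfolding st by simp
  finally show ?thesis using 1 2 3 by argo
qed

text \<open>Among the three deviations from the mean, two have weakly the same sign. The inequality
  is symmetric, so a cyclic rotation makes these two the first two points.\<close>

lemma popoviciu:
  fixes g :: "real \<Rightarrow> real"
  assumes cv: "convex_on S g" and S: "x \<in> S" "y \<in> S" "z \<in> S"
  shows "2 / 3 * (g ((x + y) / 2) + g ((y + z) / 2) + g ((z + x) / 2))
           \<le> (g x + g y + g z) / 3 + g ((x + y + z) / 3)"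
proof -
  define c where "c = (x + y + z) / 3"
  consider "(c - x) * (c - y) \<ge> 0" | "(c - y) * (c - z) \<ge> 0" | "(c - z) * (c - x) \<ge> 0"
    by (metis linorder_le_cases diff_ge_0_iff_ge diff_le_0_iff_le mult_nonneg_nonneg mult_nonpos_nonpos)
  then show ?thesis
  proof cases
    case 1
    from popoviciu_same_side[OF cv S c_def 1] show ?thesis by (simp add: c_def)
  next
    case 2
    from popoviciu_same_side[OF cv S(2,3,1) _ 2] show ?thesis by (simp add: c_def ac_simps)
  next
    case 3
    from popoviciu_same_side[OF cv S(3,1,2) _ 3] show ?thesis by (simp add: c_def ac_simps)
  qed
qed

text \<open>Restricting the derivative from \<open>S\<close> to the segment \<open>{x..y}\<close>
  reduces this to the usual mean value theorem, even when \<open>x\<close> or \<open>y\<close> is an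
  endpoint of \<open>S\<close> and the derivative there is one-sided.\<close>

lemma mvt_within:
  fixes f :: "real \<Rightarrow> real"
  assumes "convex S" and f: "\<And>x. x \<in> S \<Longrightarrow> (f has_real_derivative f' x) (at x within S)"
    and "x \<in> S" "y \<in> S" "x < y"
  obtains u where "u \<in> S" "x < u" "u < y" "f y - f x = f' u * (y - x)"
proof -
  have sub: "{x..y} \<subseteq> S"
    using assms(1,3,4) by (metis interval_subset_is_interval is_interval_convex_1 cbox_interval)
  have "(f has_derivative (*) (f' u)) (at u within {x..y})" if "x \<le> u" "u \<le> y" for u
    using has_field_derivative_subset[OF f sub] that sub
    by (auto simp: has_field_derivative_def)
  from mvt_simple[OF \<open>x < y\<close> this] obtain u where "u \<in> {x<..<y}" "f y - f x = f' u * (y - x)"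
    by blast
  with sub show thesis by (intro that[of u]) auto
qed

lemma second_derivative_within_nonneg_imp_convex:
  fixes f :: "real \<Rightarrow> real"
  assumes S: "convex S"
    and f: "\<And>x. x \<in> S \<Longrightarrow> (f has_real_derivative f' x) (at x within S)"
    and f': "\<And>x. x \<in> S \<Longrightarrow> (f' has_real_derivative f'' x) (at x within S)"
    and pos: "\<And>x. x \<in> S \<Longrightarrow> 0 \<le> f'' x"
  shows "convex_on S f"
proof (rule pos_convex_function[OF S])
  have mono: "f' x \<le> f' y" if xy: "x \<in> S" "y \<in> S" "x < y" for x y
  proof -
    obtain u where "u \<in> S" "f' y - f' x = f'' u * (y - x)"
      using mvt_within[OF S f' xy] by blast
    moreover from this pos xy have "0 \<le> f'' u * (y - x)" by simp
    ultimately show ?thesis by linarith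
  qed
  fix x y assume xy: "x \<in> S" "y \<in> S"
  \<comment> \<open>The graph lies above each tangent: the slope of the chord is \<open>f' u\<close>
    for some \<open>u\<close> strictly between the points, and \<open>f'\<close> is
    monotone.\<close>
  show "f' x * (y - x) \<le> f y - f x"
  proof (cases x y rule: linorder_cases)
    case less
    obtain u where "u \<in> S" "x < u" "f y - f x = f' u * (y - x)"
      using mvt_within[OF S f xy less] by blast
    with mono[of x u] xy less show ?thesis by simp
  next
    case greater
    obtain u where u: "u \<in> S" "u < x" "f x - f y = f' u * (x - y)"
      using mvt_within[OF S f xy(2,1) greater] by blast
    have "f' u * (x - y) \<le> f' x * (x - y)"
      using mono[of u x] u xy greater by simp
    with u show ?thesis by (simp add: algebra_simps)
  qed simp
qed

theorem proposition1:
  fixes f :: "real \<Rightarrow> real" and a b M m x y z :: real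
  assumes "a < b"
    and "C2_on {a..b} f"
    and "M = (SUP t\<in>{a..b}. deriv_within {a..b} (deriv_within {a..b} f) t)"
    and "m = (INF t\<in>{a..b}. deriv_within {a..b} (deriv_within {a..b} f) t)"
    and "x \<in> {a..b}" and "y \<in> {a..b}" and "z \<in> {a..b}"
  shows "M / 36 * ((x - y)\<^sup>2 + (y - z)\<^sup>2 + (z - x)\<^sup>2)
           \<ge> (f x + f y + f z) / 3 + f ((x + y + z) / 3)
             - 2 / 3 * (f ((x + y) / 2) + f ((y + z) / 2) + f ((z + x) / 2))
       \<and> (f x + f y + f z) / 3 + f ((x + y + z) / 3)
             - 2 / 3 * (f ((x + y) / 2) + f ((y + z) / 2) + f ((z + x) / 2))
           \<ge> m / 36 * ((x - y)\<^sup>2 + (y - z)\<^sup>2 + (z - x)\<^sup>2)"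
proof -
  define I f' f'' where "I = {a..b}" and "f' = deriv_within I f" and "f'' = deriv_within I f'"
  have I: "convex I" "x \<in> I" "y \<in> I" "z \<in> I" using assms by (auto simp: I_def)
  have C2: "f differentiable_on I" "f' differentiable_on I" "continuous_on I f''"
    using assms(2) by (auto simp: C2_on_def I_def f'_def f''_def)
  have df: "(f has_real_derivative f' t) (at t within I)" if "t \<in> I" for t
    using C2(1) that vector_derivative_works[of f "at t within I"]
    by (simp add: differentiable_on_def f'_def deriv_within_def
        has_real_derivative_iff_has_vector_derivative)
  have df': "(f' has_real_derivative f'' t) (at t within I)" if "t \<in> I" for t
    using C2(2) that vector_derivative_works[of f' "at t within I"]
    by (simp add: differentiable_on_def f''_def deriv_within_def
        has_real_derivative_iff_has_vector_derivative)
  \<comment> \<open>A real \<open>SUP\<close> or \<open>INF\<close> bounds its set only if that set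
    is bounded; continuity on a compact interval ensures this.\<close>
  have "compact (f'' ` I)"
    using C2(3) by (rule compact_continuous_image) (simp add: I_def)
  then have bdd: "bdd_above (f'' ` I)" "bdd_below (f'' ` I)"
    by (simp_all add: bounded_imp_bdd_above bounded_imp_bdd_below compact_imp_bounded)
  have M: "f'' t \<le> M" and m: "m \<le> f'' t" if "t \<in> I" for t
    using cSUP_upper[OF that bdd(1)] cINF_lower[OF bdd(2) that] assms(3,4)
    by (simp_all add: f''_def f'_def I_def)
  have upper: "convex_on I (\<lambda>t. M * t\<^sup>2 / 2 - f t)"
  proof (rule second_derivative_within_nonneg_imp_convex[OF I(1)])
    fix t assume t: "t \<in> I"
    show "((\<lambda>t. M * t\<^sup>2 / 2 - f t) has_real_derivative M * t - f' t) (at t within I)"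
      by (auto intro!: derivative_eq_intros df[OF t])
    show "((\<lambda>t. M * t - f' t) has_real_derivative M - f'' t) (at t within I)"
      by (auto intro!: derivative_eq_intros df'[OF t])
    show "0 \<le> M - f'' t" using M[OF t] by simp
  qed
  have lower: "convex_on I (\<lambda>t. f t - m * t\<^sup>2 / 2)"
  proof (rule second_derivative_within_nonneg_imp_convex[OF I(1)])
    fix t assume t: "t \<in> I"
    show "((\<lambda>t. f t - m * t\<^sup>2 / 2) has_real_derivative f' t - m * t) (at t within I)"
      by (auto intro!: derivative_eq_intros df[OF t])
    show "((\<lambda>t. f' t - m * t) has_real_derivative f'' t - m) (at t within I)"
      by (auto intro!: derivative_eq_intros df'[OF t])
    show "0 \<le> f'' t - m" using m[OF t] by simp
  qed
  \<comment> \<open>The difference of the two sides of Popoviciu's inequality is linear in the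
    function. This is its value at \<open>k * t\<^sup>2 / 2\<close>, which explains the constant
    36.\<close>
  have quadratic: "k / 36 * ((x - y)\<^sup>2 + (y - z)\<^sup>2 + (z - x)\<^sup>2)
      = (k * x\<^sup>2 / 2 + k * y\<^sup>2 / 2 + k * z\<^sup>2 / 2) / 3 + k * ((x + y + z) / 3)\<^sup>2 / 2
        - 2 / 3 * (k * ((x + y) / 2)\<^sup>2 / 2 + k * ((y + z) / 2)\<^sup>2 / 2 + k * ((z + x) / 2)\<^sup>2 / 2)"
    for k :: real
    by (simp add: power2_eq_square field_simps)
  show ?thesis
    unfolding quadratic using popoviciu[OF upper I(2-4)] popoviciu[OF lower I(2-4)] by argo
qed

end
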